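(* Let $c=(c_1,\dots,c_n)$ be an almost Łukasiewicz configuration with $n$ balls and defect $j$. Then $$A_c(q)=\prod_{a\in\mathrm{MSet}(c)}[a]\;-\;\genfrac{[}{]}{0pt}{}{n+1}{j}\prod_{a\in\mathrm{MSet}(c),\,a<j}[a]\prod_{b\in\mathrm{MSet}(c),\,b>j}[b-j].$$
   Context: A configuration of size $n$ is a tuple $c=(c_1,\dots,c_n)$ of nonnegative integers with $\sum_i c_i=n$, viewed as $c_i$ balls at site $i\in\mathbb{Z}$; $\mathrm{MSet}(c)$ is the multiset containing each $i\in[1;n]$ with multiplicity $c_i$. Fix real $q>0$. Random dynamic: balls are dropped onto $\mathbb{Z}$ one at a time from their sites; a ball landing on an occupied site moves one site left with probability $q/(1+q)$ and right with probability $1/(1+q)$, repeating until it reaches an unoccupied site, where it settles; the law of the final occupied set does not depend on the dropping order. $\mathbb{P}_c(q)$ is the probability that the final occupied set is $[1;n]$. $[i]=1+q+\dots+q^{i-1}$, $[n]!=[1]\cdots[n]$, $\genfrac{[}{]}{0pt}{}{n}{k}=\frac{[n]!}{[k]![n-k]!}$, and $A_c(q)=[n]!\,\mathbb{P}_c(q)$. The height of $c$ at $k$ is $H_{c,k}=\sum_{i=1}^k(c_i-1)$. The configuration $c$ is almost Łukasiewicz if all heights $H_{c,k}$, $k\in[1;n]$, are nonnegative except for exactly one index $j$ (necessarily with $H_{c,j}=-1$); this $j$ is called the defect of $c$. *)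

theory Defs
  imports "HOL-Probability.SPMF" "HOL-Library.Multiset"
begin

definition configuration :: "nat \<Rightarrow> (nat \<Rightarrow> nat) \<Rightarrow> bool" where
  "configuration n c \<longleftrightarrow> (\<Sum>i=1..n. c i) = n"

definition MSet :: "nat \<Rightarrow> (nat \<Rightarrow> nat) \<Rightarrow> nat multiset" where
  "MSet n c = (\<Sum>i=1..n. replicate_mset (c i) i)"

definition height :: "(nat \<Rightarrow> nat) \<Rightarrow> nat \<Rightarrow> int" where
  "height c k = (\<Sum>i=1..k. int (c i) - 1)"

definition almost_lukasiewicz :: "nat \<Rightarrow> (nat \<Rightarrow> nat) \<Rightarrow> bool" where
  "almost_lukasiewicz n c \<longleftrightarrow>
     configuration n c \<and> (\<exists>!j. j \<in> {1..n} \<and> height c j < 0)"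

definition defect :: "nat \<Rightarrow> (nat \<Rightarrow> nat) \<Rightarrow> nat" where
  "defect n c = (THE j. j \<in> {1..n} \<and> height c j < 0)"

definition q_num :: "real \<Rightarrow> nat \<Rightarrow> real" where
  "q_num q i = (\<Sum>k<i. q ^ k)"

definition q_fact :: "real \<Rightarrow> nat \<Rightarrow> real" where
  "q_fact q n = (\<Prod>i=1..n. q_num q i)"

definition q_binom :: "real \<Rightarrow> nat \<Rightarrow> nat \<Rightarrow> real" where
  "q_binom q n k = q_fact q n / (q_fact q k * q_fact q (n - k))"

text \<open>
  \<open>settle q S x\<close> is the law of the site at which a ball landing at \<open>x\<close> comes to rest when \<open>S\<close> is
  the set of occupied sites; the outcome \<open>True\<close> of the coin is a step to the left. The least fixed
  point assigns to each site the probability that the walk stops there after finitely many steps.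
\<close>

partial_function (spmf) settle :: "real \<Rightarrow> int set \<Rightarrow> int \<Rightarrow> int spmf" where
  "settle q S x =
     (if x \<in> S
      then bind_spmf (spmf_of_pmf (bernoulli_pmf (q / (1 + q))))
             (\<lambda>left. settle q S (if left then x - 1 else x + 1))
      else return_spmf x)"

primrec drop_balls :: "real \<Rightarrow> int list \<Rightarrow> int set \<Rightarrow> int set spmf" where
  "drop_balls q [] S = return_spmf S"
| "drop_balls q (x # xs) S = bind_spmf (settle q S x) (\<lambda>y. drop_balls q xs (insert y S))"

text \<open>
  The balls are dropped from left to right; by \<open>drop_balls_order\<close> below, any other order gives the
  same law.
\<close>

definition P_conf :: "real \<Rightarrow> nat \<Rightarrow> (nat \<Rightarrow> nat) \<Rightarrow> real" where
  "P_conf q n c =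
     spmf (drop_balls q (map int (sorted_list_of_multiset (MSet n c))) {}) {1..int n}"

definition A_conf :: "real \<Rightarrow> nat \<Rightarrow> (nat \<Rightarrow> nat) \<Rightarrow> real" where
  "A_conf q n c = q_fact q n * P_conf q n c"

lemma harmonic_le_0:
  fixes d :: "int \<Rightarrow> real" and p :: real
  assumes fin: "finite S" and p: "0 < p" "p < 1"
    and harm: "\<And>x. x \<in> S \<Longrightarrow> d x = p * d (x - 1) + (1 - p) * d (x + 1)"
    and bd: "\<And>x. x \<notin> S \<Longrightarrow> d x = 0"
  shows "d x \<le> 0"
proof (rule ccontr)
  assume "\<not> d x \<le> 0"
  hence pos: "d x > 0" and xS: "x \<in> S" using bd by force+
  define M where "M = Max (d ` S)"
  have le: "d y \<le> M" if "y \<in> S" for y using that fin by (simp add: M_def)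
  have M0: "M > 0" using le[OF xS] pos by linarith
  have leM: "d y \<le> M" for y using le bd M0 by (cases "y \<in> S") force+
  define Z where "Z = {y \<in> S. d y = M}"
  have "M \<in> d ` S" unfolding M_def using fin xS by (intro Max_in) auto
  hence Z: "finite Z" "Z \<noteq> {}" using fin by (auto simp: Z_def)
  define z where "z = Max Z"
  have "z \<in> Z" using Z by (simp add: z_def)
  hence zS: "z \<in> S" and dz: "d z = M" by (auto simp: Z_def)
  have "p * d (z - 1) \<le> p * M" using p leM by (intro mult_left_mono) auto
  hence "(1 - p) * M \<le> (1 - p) * d (z + 1)"
    using harm[OF zS] dz by (simp add: algebra_simps)
  hence "M \<le> d (z + 1)" using p by simp
  hence eq: "d (z + 1) = M" using leM[of "z + 1"] by linarith
  hence "z + 1 \<in> Z" using bd[of "z + 1"] M0 by (auto simp: Z_def)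
  hence "z + 1 \<le> z" unfolding z_def using Z by (intro Max_ge)
  thus False by simp
qed

lemma harmonic_eq_0:
  fixes d :: "int \<Rightarrow> real" and p :: real
  assumes "finite S" "0 < p" "p < 1"
    and "\<And>x. x \<in> S \<Longrightarrow> d x = p * d (x - 1) + (1 - p) * d (x + 1)"
    and "\<And>x. x \<notin> S \<Longrightarrow> d x = 0"
  shows "d x = 0"
proof -
  have "d x \<le> 0" using harmonic_le_0[OF assms] .
  moreover have "- d x \<le> 0"
  proof (rule harmonic_le_0[OF assms(1-3), where d = "\<lambda>x. - d x"])
    fix x assume "x \<in> S"
    from assms(4)[OF this] show "- d x = p * - d (x - 1) + (1 - p) * - d (x + 1)" by simp
  qed (simp add: assms(5))
  ultimately show ?thesis by linarith
qed

lemma settle_in: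
  "x \<in> S \<Longrightarrow> settle q S x =
     bind_spmf (spmf_of_pmf (bernoulli_pmf (q / (1 + q))))
       (\<lambda>left. settle q S (if left then x - 1 else x + 1))"
  by (subst settle.simps) simp

lemma settle_notin: "x \<notin> S \<Longrightarrow> settle q S x = return_spmf x"
  by (subst settle.simps) simp

lemma spmf_bind_bernoulli:
  assumes "0 \<le> p" "p \<le> 1"
  shows "spmf (bind_spmf (spmf_of_pmf (bernoulli_pmf p)) f) T =
           p * spmf (f True) T + (1 - p) * spmf (f False) T"
  using assms by (simp add: spmf_bind integral_measure_pmf[of UNIV] UNIV_bool
      del: bind_spmf_of_pmf)

lemma drop_balls_pair_commute:
  assumes q: "q > 0" and fin: "finite S"
  shows "drop_balls q [x, y] S = drop_balls q [y, x] S"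
proof (rule spmf_eqI)
  fix T
  define p where "p = q / (1 + q)"
  have p: "0 < p" "p < 1" using q by (simp_all add: p_def)
  define G where "G x y = spmf (drop_balls q [x, y] S) T" for x y
  have first: "G x y = p * G (x - 1) y + (1 - p) * G (x + 1) y" if "x \<in> S" for x y
  proof -
    have "drop_balls q [x, y] S =
        bind_spmf (spmf_of_pmf (bernoulli_pmf p))
          (\<lambda>left. drop_balls q [if left then x - 1 else x + 1, y] S)"
      using settle_in[OF that, of q] by (simp add: p_def del: bind_spmf_of_pmf)
    thus ?thesis unfolding G_def using p by (simp add: spmf_bind_bernoulli del: drop_balls.simps bind_spmf_of_pmf)
  qed
  have second: "G y x = p * G y (x - 1) + (1 - p) * G y (x + 1)" if "x \<in> S" for x y
  proof -
    have "settle q (insert u S) x =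
        bind_spmf (spmf_of_pmf (bernoulli_pmf p))
          (\<lambda>left. settle q (insert u S) (if left then x - 1 else x + 1))" for u
      using settle_in[of x "insert u S" q] that by (simp add: p_def del: bind_spmf_of_pmf)
    hence "drop_balls q [y, x] S =
        bind_spmf (settle q S y) (\<lambda>u. bind_spmf (spmf_of_pmf (bernoulli_pmf p))
          (\<lambda>left. drop_balls q [if left then x - 1 else x + 1] (insert u S)))"
      by (simp del: bind_spmf_of_pmf)
    also have "\<dots> = bind_spmf (spmf_of_pmf (bernoulli_pmf p))
          (\<lambda>left. drop_balls q [y, if left then x - 1 else x + 1] S)"
      by (subst bind_commute_spmf) (simp del: bind_spmf_of_pmf)
    finally show ?thesis
      unfolding G_def using p by (simp add: spmf_bind_bernoulli del: drop_balls.simps bind_spmf_of_pmf)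
  qed
  have out: "G x y - G y x = 0" if "x \<notin> S" "y \<notin> S" for x y
  proof (cases "x = y")
    case False
    thus ?thesis using that by (simp add: G_def settle_notin insert_commute)
  qed simp
  have out1: "G x y - G y x = 0" if "x \<notin> S" for x y
  proof (rule harmonic_eq_0[OF fin p, where d = "\<lambda>y. G x y - G y x"])
    fix y assume "y \<in> S"
    from first[OF this, of x] second[OF this, of x]
    show "G x y - G y x = p * (G x (y - 1) - G (y - 1) x) + (1 - p) * (G x (y + 1) - G (y + 1) x)"
      by (simp add: algebra_simps)
  qed (use out that in auto)
  have "G x y - G y x = 0"
  proof (rule harmonic_eq_0[OF fin p, where d = "\<lambda>x. G x y - G y x"])
    fix x assume "x \<in> S"
    from first[OF this, of y] second[OF this, of y]
    show "G x y - G y x = p * (G (x - 1) y - G y (x - 1)) + (1 - p) * (G (x + 1) y - G y (x + 1))"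
      by (simp add: algebra_simps)
  qed (use out1 in auto)
  thus "spmf (drop_balls q [x, y] S) T = spmf (drop_balls q [y, x] S) T"
    by (simp add: G_def)
qed

lemma drop_balls_append:
  "drop_balls q (xs @ ys) S = bind_spmf (drop_balls q xs S) (drop_balls q ys)"
  by (induction xs arbitrary: S) simp_all

lemma drop_balls_move_front:
  assumes "q > 0"
  shows "finite S \<Longrightarrow> drop_balls q (xs @ x # ys) S = drop_balls q (x # xs @ ys) S"
proof (induction xs arbitrary: S)
  case (Cons z zs)
  have "drop_balls q ((z # zs) @ x # ys) S = drop_balls q ([z, x] @ zs @ ys) S"
    using Cons by simp
  also have "\<dots> = drop_balls q ([x, z] @ zs @ ys) S"
    by (simp only: drop_balls_append[of q "[z, x]"] drop_balls_append[of q "[x, z]"]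
        drop_balls_pair_commute[OF assms Cons.prems, of z x])
  finally show ?case by simp
qed simp

lemma drop_balls_order:
  assumes "q > 0"
  shows "finite S \<Longrightarrow> mset xs = mset ys \<Longrightarrow> drop_balls q xs S = drop_balls q ys S"
proof (induction xs arbitrary: ys S)
  case (Cons x xs)
  have "x \<in> set ys" using Cons.prems(2) by (metis list.set_intros(1) set_mset_mset)
  then obtain us vs where ys: "ys = us @ x # vs" by (auto dest: split_list)
  have "mset xs = mset (us @ vs)" using Cons.prems(2) by (simp add: ys)
  from Cons.IH[OF _ this] Cons.prems(1)
  have "drop_balls q (x # xs) S = drop_balls q (x # us @ vs) S"
    by simp
  also have "\<dots> = drop_balls q ys S"
    unfolding ys using drop_balls_move_front[OF assms Cons.prems(1)] by simp
  finally show ?case .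
qed simp

end

theory Submission
  imports Defs
begin

text \<open>
  Drop the balls from left to right. By gambler's ruin, a ball landing at the \<open>i\<close>-th site of a block
  of \<open>N - 1\<close> occupied sites leaves it on the right with probability \<open>[i] / [N]\<close>. The \<open>j - 1\<close> balls
  left of the defect must fill \<open>[1; j - 1]\<close>, so each of them exits on the right. The balls right of
  the defect build a block starting at \<open>j + 1\<close> until one of them exits this block on the left and fills
  \<open>j\<close>; all later balls must exit on the right again. Conditioning on one ball at a time turns the sum
  over the ball that fills \<open>j\<close> into a recursion, whose closed form rests on the identity
  \<open>[k] [b + j] - [j + k] [b] = q^b [j] [k - b]\<close>.
\<close>

section \<open>Arithmetic of q-numbers and q-factorials\<close>

lemma q_num_0 [simp]: "q_num q 0 = 0"
  by (simp add: q_num_def)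

lemma q_num_Suc: "q_num q (Suc n) = q_num q n + q ^ n"
  by (simp add: q_num_def)

lemma q_num_pos: "q > 0 \<Longrightarrow> n > 0 \<Longrightarrow> q_num q n > 0"
  unfolding q_num_def by (intro sum_pos) auto

lemma q_num_add: "q_num q (m + n) = q_num q m + q ^ m * q_num q n"
  by (induction n) (simp_all add: q_num_Suc algebra_simps power_add)

text \<open>Once every sum is split by \<open>q_num_add\<close>, all that is used is that
  \<open>[b + j]\<close> can be split in two orders, recorded as \<open>comm\<close>. Here
  \<open>b + d\<close> is the \<open>k\<close> of the identity above.\<close>

lemma q_num_exchange:
  "q_num q (b + d) * q_num q (b + j) = q_num q (b + j + d) * q_num q b + q ^ b * q_num q j * q_num q d"
proof -
  have comm: "q_num q b + q ^ b * q_num q j = q_num q j + q ^ j * q_num q b"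
    by (metis add.commute q_num_add)
  have "(B + P * D) * (B + P * J) = (B + P * J + P * Q * D) * B + P * J * D"
    if "B + P * J = J + Q * B" for B P D J Q :: real
    using that by algebra
  from this[OF comm] show ?thesis by (simp add: q_num_add power_add)
qed

lemma q_fact_0 [simp]: "q_fact q 0 = 1"
  by (simp add: q_fact_def)

lemma q_fact_Suc: "q_fact q (Suc n) = q_fact q n * q_num q (Suc n)"
  by (simp add: q_fact_def)

lemma q_fact_pos: "q > 0 \<Longrightarrow> q_fact q n > 0"
  unfolding q_fact_def by (intro prod_pos) (auto intro: q_num_pos)

section \<open>Gambler's ruin on a block\<close>

text \<open>From \<open>Suc i\<close>, a step right raises the q-number by \<open>q ^ Suc i\<close>
  and a step left lowers it by \<open>q ^ i\<close>; the odds \<open>1 : q\<close> balance the two,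
  so \<open>q_num q\<close> is harmonic for the walk.\<close>

lemma q_num_gambler:
  assumes "q > 0"
  shows "q_num q (Suc i) = q / (1 + q) * q_num q i + (1 - q / (1 + q)) * q_num q (Suc (Suc i))"
proof -
  have "1 - q / (1 + q) = 1 / (1 + q)" "1 + q \<noteq> 0" using assms by (simp_all add: field_simps)
  thus ?thesis by (simp add: q_num_Suc divide_simps) (simp add: algebra_simps)
qed

text \<open>As functions of the starting site, both sides are harmonic inside the block and agree at
  its two free ends, so \<open>harmonic_eq_0\<close> identifies them. The continuation
  \<open>f\<close> carries all later balls.\<close>

lemma spmf_bind_settle:
  assumes q: "q > 0" and N: "N > 0" and i: "i \<le> N"
    and S: "{l<..<l + int N} \<subseteq> S" "l \<notin> S" "l + int N \<notin> S"
  shows "spmf (bind_spmf (settle q S (l + int i)) f) T =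
           q_num q i / q_num q N * spmf (f (l + int N)) T +
           (1 - q_num q i / q_num q N) * spmf (f l) T"
proof -
  define p where "p = q / (1 + q)"
  have p: "0 < p" "p < 1" using q by (simp_all add: p_def)
  define u where "u = spmf (f (l + int N)) T"
  define v where "v = spmf (f l) T"
  define E where "E x = spmf (bind_spmf (settle q S x) f) T" for x
  \<comment> \<open>The interpolation, affine in the q-number, between \<open>v\<close> at
    \<open>l\<close> and \<open>u\<close> at \<open>l + int N\<close>.\<close>
  define h where "h x = q_num q (nat (x - l)) / q_num q N * (u - v) + v" for x
  \<comment> \<open>Cutting off outside the open interval supplies the zero boundary values that
    \<open>harmonic_eq_0\<close> asks for.\<close>
  define d where "d x = (if x \<in> {l<..<l + int N} then E x - h x else 0)" for x
  have Nn: "q_num q N \<noteq> 0" using q_num_pos[OF q N] by simp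
  have El: "E l = h l" using S by (simp add: E_def h_def settle_notin v_def)
  have Er: "E (l + int N) = h (l + int N)"
    using S Nn by (simp add: E_def h_def settle_notin u_def)
  \<comment> \<open>The closed interval is needed because a neighbour of an interior site may be an
    end.\<close>
  have d_eq: "d x = E x - h x" if "x \<in> {l..l + int N}" for x
    using that El Er by (cases "x = l"; cases "x = l + int N") (auto simp: d_def)
  have harmE: "E x = p * E (x - 1) + (1 - p) * E (x + 1)" if "x \<in> {l<..<l + int N}" for x
  proof -
    have "x \<in> S" using that S by auto
    hence "bind_spmf (settle q S x) f = bind_spmf (spmf_of_pmf (bernoulli_pmf p))
             (\<lambda>left. bind_spmf (settle q S (if left then x - 1 else x + 1)) f)"
      by (subst settle_in) (simp_all add: p_def del: bind_spmf_of_pmf)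
    thus ?thesis unfolding E_def using p by (simp add: spmf_bind_bernoulli del: bind_spmf_of_pmf)
  qed
  have harmh: "h x = p * h (x - 1) + (1 - p) * h (x + 1)" if "x \<in> {l<..<l + int N}" for x
  proof -
    define k where "k = nat (x - 1 - l)"
    have k: "nat (x - 1 - l) = k" "nat (x - l) = Suc k" "nat (x + 1 - l) = Suc (Suc k)"
      using that by (auto simp: k_def)
    have "(p * a + (1 - p) * b) / m * w + v = p * (a / m * w + v) + (1 - p) * (b / m * w + v)"
      for a b m w v :: real
      by (simp add: algebra_simps add_divide_distrib diff_divide_distrib)
    thus ?thesis unfolding h_def k q_num_gambler[OF q, of k, folded p_def] .
  qed
  have "d (l + int i) = 0"
  proof (rule harmonic_eq_0[OF _ p, of "{l<..<l + int N}"])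
    fix x assume x: "x \<in> {l<..<l + int N}"
    hence dx: "d x = E x - h x" "d (x - 1) = E (x - 1) - h (x - 1)" "d (x + 1) = E (x + 1) - h (x + 1)"
      by (auto intro!: d_eq)
    show "d x = p * d (x - 1) + (1 - p) * d (x + 1)"
      unfolding dx by (subst harmE[OF x], subst harmh[OF x]) (simp add: algebra_simps)
  qed (auto simp: d_def)
  hence "E (l + int i) = h (l + int i)" using d_eq[of "l + int i"] i by simp
  thus ?thesis by (simp add: E_def h_def u_def v_def algebra_simps)
qed

section \<open>Filling a block, without and with a gap\<close>

lemma set_spmf_drop_balls: "T \<in> set_spmf (drop_balls q xs S) \<Longrightarrow> S \<subseteq> T"
  by (induction xs arbitrary: S) (auto simp: set_bind_spmf)

lemma spmf_drop_balls_eq_0: "\<not> S \<subseteq> T \<Longrightarrow> spmf (drop_balls q xs S) T = 0"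
  using set_spmf_drop_balls by (metis spmf_eq_0_set_spmf)

text \<open>The bound keeps each ball within reach of the current block. A ball leaving on the left
  would occupy \<open>0\<close>, outside \<open>T\<close>, so only right exits count; their
  probabilities \<open>[x] / [k + i + 1]\<close> multiply up.\<close>

lemma spmf_drop_balls_block:
  assumes q: "q > 0" and T: "0 \<notin> T"
  shows "(\<And>i. i < length xs \<Longrightarrow> xs ! i \<le> k + i + 1) \<Longrightarrow>
    spmf (drop_balls q (map int xs @ ys) {1..int k}) T =
      prod_list (map (q_num q) xs) * q_fact q k / q_fact q (k + length xs) *
      spmf (drop_balls q ys {1..int (k + length xs)}) T"
proof (induction xs arbitrary: k)
  case Nil
  show ?case using q_fact_pos[OF q, of k] by simp
next
  case (Cons x xs)
  have x: "x \<le> Suc k" using Cons.prems[of 0] by simp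
  have dead: "spmf (drop_balls q zs (insert 0 {1..int k})) T = 0" for zs
    using T by (intro spmf_drop_balls_eq_0) auto
  have sub: "{0<..<int (Suc k)} \<subseteq> {1..int k}"
    and ins: "insert (int (Suc k)) {1..int k} = {1..int (Suc k)}" by auto
  have "spmf (drop_balls q (map int (x # xs) @ ys) {1..int k}) T =
      q_num q x / q_num q (Suc k) * spmf (drop_balls q (map int xs @ ys) {1..int (Suc k)}) T"
    using spmf_bind_settle[OF q _ x, of 0 "{1..int k}"
        "\<lambda>y. drop_balls q (map int xs @ ys) (insert y {1..int k})" T]
    by (simp add: dead ins sub del: of_nat_Suc)
  also have "spmf (drop_balls q (map int xs @ ys) {1..int (Suc k)}) T =
      prod_list (map (q_num q) xs) * q_fact q (Suc k) / q_fact q (Suc k + length xs) *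
      spmf (drop_balls q ys {1..int (Suc k + length xs)}) T"
    by (rule Cons.IH) (use Cons.prems[of "Suc _"] in auto)
  finally show ?case
    using q_num_pos[OF q, of "Suc k"] by (simp add: q_fact_Suc)
qed

text \<open>
  The maximum matters only for \<open>k = i = 0\<close>, where the ball lands on the free site \<open>j + 1\<close> and so
  cannot fill \<open>j\<close>. Every other ball has to stay within reach of the block that results from filling \<open>j\<close>.
\<close>

lemma spmf_drop_balls_gap:
  assumes q: "q > 0" and j: "0 < j" "j \<le> n"
  shows "j + k + length bs = n + 1 \<Longrightarrow>
    (\<And>i. i < length bs \<Longrightarrow> j < bs ! i \<and> bs ! i \<le> max (j + 1) (j + k + i)) \<Longrightarrow>
    spmf (drop_balls q (map int bs) ({1..int j - 1} \<union> {int j + 1..int j + int k})) {1..int n} =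
      (prod_list (map (q_num q) bs) * q_fact q (j + k) / q_fact q n -
       q_num q (n + 1) * prod_list (map (\<lambda>b. q_num q (b - j)) bs) * q_fact q k
         / q_fact q (k + length bs)) / q_num q j"
proof (induction bs arbitrary: k)
  case Nil
  \<comment> \<open>With no ball left, \<open>j\<close> stays empty and the probability is 0. The
    right side also vanishes, since \<open>j + k = n + 1\<close>.\<close>
  have "int j \<in> {1..int n}" using j by simp
  hence "{1..int j - 1} \<union> {int j + 1..int j + int k} \<noteq> {1..int n}" by auto
  thus ?case using q_fact_pos[OF q, of n] q_fact_pos[OF q, of k] Nil
    by (simp add: q_fact_Suc)
next
  case (Cons b bs)
  define G where "G k = {1..int j - 1} \<union> {int j + 1..int j + int k}" for k
  \<comment> \<open>The walk takes place between the free sites \<open>j\<close> and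
    \<open>j + k + 1\<close>; \<open>d\<close> and \<open>e\<close> are the distances of
    \<open>b\<close> to these two.\<close>
  define d where "d = b - j"
  have d: "b = d + j" "d \<le> Suc k" using Cons.prems(2)[of 0] by (auto simp: d_def)
  define e where "e = Suc k - d"
  have e: "Suc k = d + e" using d by (simp add: e_def)
  define F where "F = q_fact q (j + k)"
  \<comment> \<open>\<open>X\<close> is the success probability of the later balls once
    \<open>j\<close> is filled; \<open>Y\<close> is the subtracted term without the factor of
    \<open>b\<close>.\<close>
  define X where "X = prod_list (map (q_num q) bs) * F / q_fact q n"
  define Y where "Y = q_num q (n + 1) * prod_list (map (\<lambda>b. q_num q (b - j)) bs) * q_fact q k
         / q_fact q (k + length (b # bs))"
  have pos: "q_num q j > 0" "q_num q (Suc k) > 0"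
    using q j by (auto intro: q_num_pos)
  have ins: "insert (int j + int (Suc k)) (G k) = G (Suc k)"
    "insert (int j) (G k) = {1..int (j + k)}"
    using j by (auto simp: G_def)
  have gap: "{int j<..<int j + int (Suc k)} \<subseteq> G k" "int j \<notin> G k" "int j + int (Suc k) \<notin> G k"
    by (auto simp: G_def)
  have fill: "spmf (drop_balls q (map int bs) {1..int (j + k)}) {1..int n} = X"
  proof -
    have "j + k + length bs = n" using Cons.prems(1) by simp
    moreover have "bs ! i \<le> j + k + i + 1" if "i < length bs" for i
      using Cons.prems(2)[of "Suc i"] that by simp
    ultimately show ?thesis
      using spmf_drop_balls_block[OF q, of "{1..int n}" bs "j + k" "[]"]
      by (simp add: X_def F_def)
  qed
  have rest: "spmf (drop_balls q (map int bs) (G (Suc k))) {1..int n} =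
      (X * q_num q (Suc (j + k)) - Y * q_num q (Suc k)) / q_num q j"
    using Cons.IH[of "Suc k"] Cons.prems(1) Cons.prems(2)[of "Suc _"]
    by (simp add: G_def X_def Y_def F_def q_fact_Suc algebra_simps)
  \<comment> \<open>A right exit extends the block to \<open>G (Suc k)\<close>; a left exit fills
    \<open>j\<close>.\<close>
  have "spmf (drop_balls q (map int (b # bs)) (G k)) {1..int n} =
      q_num q d / q_num q (Suc k) * ((X * q_num q (Suc (j + k)) - Y * q_num q (Suc k)) / q_num q j)
      + (1 - q_num q d / q_num q (Suc k)) * X"
    using spmf_bind_settle[OF q _ d(2) gap,
        of "\<lambda>y. drop_balls q (map int bs) (insert y (G k))" "{1..int n}"]
    by (simp only: ins fill rest) (simp add: d(1) add.commute)
  also have "\<dots> = (q_num q b * X - q_num q d * Y) / q_num q j"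
  proof -
    \<comment> \<open>The letters stand for \<open>u = [d]\<close>, \<open>m = [k + 1]\<close>,
      \<open>t = [j + k + 1]\<close>, \<open>w = [j]\<close>, \<open>s = [b]\<close>,
      \<open>z = q ^ d\<close> and \<open>v = [e]\<close>. The first premise, an instance of
      \<open>q_num_exchange\<close>, merges the two multiples of \<open>X\<close>.\<close>
    have "u / m * ((X * t - Y * m) / w) + (1 - u / m) * X = (s * X - u * Y) / w"
      if "m * s = t * u + z * w * v" "m = u + z * v" "m > 0" "w > 0" for u m t w s z v :: real
    proof -
      have "m * s = t * u + w * (m - u)" using that(1,2) by (simp add: algebra_simps)
      hence s: "s = (t * u + w * (m - u)) / m" using that(3) by (simp add: field_simps)
      show ?thesis unfolding s using that(3,4) by (simp add: divide_simps) (simp add: algebra_simps)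
    qed
    moreover have "q_num q (Suc k) * q_num q b =
        q_num q (Suc (j + k)) * q_num q d + q ^ d * q_num q j * q_num q e"
      using q_num_exchange[of q d e j] d e by (metis add.assoc add.commute add_Suc_right)
    moreover have "q_num q (Suc k) = q_num q d + q ^ d * q_num q e"
      by (simp only: e q_num_add)
    ultimately show ?thesis using pos by blast
  qed
  finally show ?case
    by (simp add: G_def X_def Y_def F_def d_def algebra_simps)
qed

section \<open>Counting the balls of a configuration\<close>

lemma size_filter_MSet: "size {#a \<in># MSet n c. P a#} = (\<Sum>i\<in>{i\<in>{1..n}. P i}. c i)"
proof -
  have "size {#a \<in># replicate_mset m i. P a#} = (if P i then m else 0)" for m i
    by (induction m) simp_all
  hence "size {#a \<in># MSet n c. P a#} = (\<Sum>i=1..n. if P i then c i else 0)"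
    by (induction n) (simp_all add: MSet_def)
  thus ?thesis by (simp only: sum.inter_filter finite_atLeastAtMost)
qed

text \<open>If entry \<open>i\<close> exceeded \<open>m\<close>, all entries up to \<open>m\<close>
  would sit at indices below \<open>i\<close>, leaving at most \<open>i\<close> of them.\<close>

lemma sorted_nth_le:
  assumes "sorted xs" "i < size {#x \<in># mset xs. x \<le> m#}"
  shows "xs ! i \<le> m"
proof (rule ccontr)
  assume "\<not> xs ! i \<le> m"
  moreover have "xs ! i \<le> xs ! k" if "i \<le> k" "k < length xs" for k
    using assms(1) that by (rule sorted_nth_mono)
  ultimately have "k < i" if "k < length xs" "xs ! k \<le> m" for k
    using that by (meson leI order_trans)
  hence "{k. k < length xs \<and> xs ! k \<le> m} \<subseteq> {..<i}" by auto
  hence "card {k. k < length xs \<and> xs ! k \<le> m} \<le> i"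
    using card_mono[OF finite_lessThan] by fastforce
  thus False using assms(2) by (simp flip: mset_filter add: length_filter_conv_card)
qed

lemma height_nonneg_iff: "height c k \<ge> 0 \<longleftrightarrow> k \<le> (\<Sum>i=1..k. c i)"
proof -
  have "height c k = int (\<Sum>i=1..k. c i) - int k"
    by (simp add: height_def sum_subtractf)
  thus ?thesis by linarith
qed

text \<open>The prefix sum is at least \<open>j - 1\<close> at \<open>j - 1\<close> but below
  \<open>j\<close> at \<open>j\<close>, so it equals \<open>j - 1\<close> at both and no ball starts
  at \<open>j\<close>. The total \<open>n\<close> excludes \<open>j = n\<close>.\<close>

lemma almost_lukasiewicz_defect:
  assumes "almost_lukasiewicz n c" "j = defect n c"
  shows "0 < j" "j < n" "c j = 0" "(\<Sum>i=1..j. c i) = j - 1"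
    "\<And>k. k \<le> n \<Longrightarrow> k \<noteq> j \<Longrightarrow> k \<le> (\<Sum>i=1..k. c i)"
proof -
  have ex: "\<exists>!j. j \<in> {1..n} \<and> height c j < 0" and n: "(\<Sum>i=1..n. c i) = n"
    using assms by (auto simp: almost_lukasiewicz_def configuration_def)
  have j: "j \<in> {1..n}" "height c j < 0"
    using theI'[OF ex] by (auto simp: assms(2) defect_def)
  show other: "k \<le> (\<Sum>i=1..k. c i)" if "k \<le> n" "k \<noteq> j" for k
  proof (cases "k = 0")
    case False
    hence "\<not> height c k < 0" using ex j that by (metis atLeastAtMost_iff less_one not_less)
    thus ?thesis using height_nonneg_iff[of c k] by linarith
  qed simp
  have less: "(\<Sum>i=1..j. c i) < j" using j(2) height_nonneg_iff[of c j] by linarith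
  show j0: "0 < j" using j by simp
  show "j < n" using j less n by (cases "j = n") auto
  have "(\<Sum>i=1..j. c i) = (\<Sum>i=1..j - 1. c i) + c j"
    using j0 by (cases j) simp_all
  moreover have "j - 1 \<le> (\<Sum>i=1..j - 1. c i)" using other[of "j - 1"] j by auto
  ultimately show "c j = 0" "(\<Sum>i=1..j. c i) = j - 1" using less by linarith+
qed

theorem theorem4p5:
  fixes q :: real and n j :: nat and c :: "nat \<Rightarrow> nat"
  assumes "q > 0"
    and "almost_lukasiewicz n c"
    and "j = defect n c"
  shows "A_conf q n c =
    (\<Prod>a\<in>#MSet n c. q_num q a) -
    q_binom q (n + 1) j *
      (\<Prod>a\<in>#{#a \<in># MSet n c. a < j#}. q_num q a) *
      (\<Prod>b\<in>#{#b \<in># MSet n c. b > j#}. q_num q (b - j))"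
proof -
  note q = assms(1) and c = almost_lukasiewicz_defect[OF assms(2,3)]
  define A where "A = {#a \<in># MSet n c. a < j#}"
  define B where "B = {#a \<in># MSet n c. a > j#}"
  define as where "as = sorted_list_of_multiset A"
  define bs where "bs = sorted_list_of_multiset B"
  have n: "(\<Sum>i=1..n. c i) = n"
    using assms(2) by (simp add: almost_lukasiewicz_def configuration_def)
  have "size {#a \<in># MSet n c. a = j#} = 0"
    using c by (simp add: size_filter_MSet)
  hence "j \<notin># MSet n c" by (auto simp: filter_mset_eq_mempty_iff)
  hence "{#a \<in># MSet n c. \<not> a < j#} = B"
    unfolding B_def by (intro filter_mset_cong) (auto simp: not_less le_less)
  hence AB: "MSet n c = A + B" unfolding A_def by (metis multiset_partition)
  have count: "size {#a \<in># MSet n c. a \<le> m#} = (\<Sum>i=1..m. c i)" if "m \<le> n" for m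
    unfolding size_filter_MSet by (rule sum.cong) (use that in auto)
  have le_j: "{#a \<in># B. a \<le> m#} = {#}" "{#a \<in># A. a \<le> j#} = A" if "m \<le> j" for m
    using that by (auto simp: A_def B_def multiset_eq_iff)
  have sizeA: "size A = j - 1"
    using count[of j] c le_j[of j] by (simp add: AB)
  have "size (MSet n c) = n"
    using size_filter_MSet[of "\<lambda>_. True" n c] n
    by (simp only: filter_mset_True simp_thms Collect_mem_eq)
  hence sizeB: "size B = n + 1 - j" using sizeA c by (simp add: AB)
  \<comment> \<open>Since \<open>i + 1 < j\<close>, at least \<open>i + 1\<close> balls start at or
    below \<open>i + 1\<close>, all of them in \<open>A\<close>.\<close>
  have nth_as: "as ! i \<le> 0 + i + 1" if "i < length as" for i
  proof -
    have i: "i + 1 < j" using that sizeA by (simp add: as_def flip: size_mset)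
    have "i + 1 \<le> size {#a \<in># A. a \<le> i + 1#}"
      using count[of "i + 1"] c(2) c(5)[of "i + 1"] i
      by (simp add: AB le_j(1) del: filter_mset_eq_mempty_iff)
    thus ?thesis by (intro sorted_nth_le) (simp_all add: as_def)
  qed
  have nth_bs: "j < bs ! i \<and> bs ! i \<le> max (j + 1) (j + 0 + i)" if i: "i < length bs" for i
  proof
    have "bs ! i \<in># B" using i by (metis bs_def mset_sorted_list_of_multiset nth_mem_mset)
    thus "j < bs ! i" by (simp add: B_def)
    \<comment> \<open>As \<open>m\<close> lies beyond the defect, at least \<open>m\<close> balls
      start at or below it. At most \<open>j - 1\<close> of these belong to \<open>A\<close>, so
      more than \<open>i\<close> belong to \<open>B\<close>.\<close>
    define m where "m = max (j + 1) (j + 0 + i)"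
    have m: "m \<le> n" "m > j" "i < m - (j - 1)"
      using i sizeB c by (auto simp: m_def bs_def simp flip: size_mset)
    have "size {#a \<in># A. a \<le> m#} \<le> j - 1"
      using sizeA by (metis size_filter_mset_lesseq)
    hence "m - (j - 1) \<le> size {#b \<in># B. b \<le> m#}"
      using count[of m] c(5)[of m] m by (simp add: AB)
    thus "bs ! i \<le> m" using m by (intro sorted_nth_le) (simp_all add: bs_def)
  qed
  have len: "length as = j - 1" "length bs = n + 1 - j"
    using sizeA sizeB by (simp_all add: as_def bs_def flip: size_mset)
  have prods: "prod_list (map f as) = (\<Prod>a\<in>#A. f a)" "prod_list (map f bs) = (\<Prod>b\<in>#B. f b)"
    for f :: "nat \<Rightarrow> real"
    by (simp_all add: as_def bs_def flip: prod_mset_prod_list)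
  have "P_conf q n c = spmf (drop_balls q (map int as @ map int bs) {}) {1..int n}"
    unfolding P_conf_def
    by (subst drop_balls_order[OF q, of _ _ "map int as @ map int bs"])
       (simp_all add: AB as_def bs_def)
  also have "\<dots> = (\<Prod>a\<in>#A. q_num q a) / q_fact q (j - 1) *
      spmf (drop_balls q (map int bs) {1..int (j - 1)}) {1..int n}"
    using spmf_drop_balls_block[OF q _ nth_as, of "{1..int n}"] by (simp add: len prods)
  \<comment> \<open>The block left of the defect is the gap state with an empty right block,
    \<open>k = 0\<close>.\<close>
  also have "{1..int (j - 1)} = {1..int j - 1} \<union> {int j + 1..int j + int 0}"
    using c by auto
  also have "spmf (drop_balls q (map int bs) \<dots>) {1..int n} =
     ((\<Prod>b\<in>#B. q_num q b) * q_fact q j / q_fact q n -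
       q_num q (n + 1) * (\<Prod>b\<in>#B. q_num q (b - j)) / q_fact q (n + 1 - j)) / q_num q j"
    using spmf_drop_balls_gap[OF q _ _ _ nth_bs, of n] c by (simp add: len prods)
  finally have P: "P_conf q n c = (\<Prod>a\<in>#A. q_num q a) / q_fact q (j - 1) *
    (((\<Prod>b\<in>#B. q_num q b) * q_fact q j / q_fact q n -
       q_num q (n + 1) * (\<Prod>b\<in>#B. q_num q (b - j)) / q_fact q (n + 1 - j)) / q_num q j)" .
  have facts: "q_fact q j = q_fact q (j - 1) * q_num q j"
    "q_fact q (n + 1) = q_fact q n * q_num q (n + 1)"
    using q_fact_Suc[of q "j - 1"] c by (simp_all add: q_fact_Suc)
  have nz: "q_fact q (j - 1) \<noteq> 0" "q_fact q n \<noteq> 0" "q_fact q (n + 1 - j) \<noteq> 0" "q_num q j \<noteq> 0"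
    using q_fact_pos[OF q] q_num_pos[OF q c(1)] by (metis less_irrefl)+
  have "N * (a / f * ((b * (f * w) / N - v * b' / g) / w)) = a * b - N * v / (f * w * g) * a * b'"
    if "f \<noteq> 0" "N \<noteq> 0" "g \<noteq> 0" "w \<noteq> 0" for N a f b w v b' g :: real
    using that by (simp add: field_simps)
  from this[OF nz] show ?thesis
    unfolding A_conf_def P q_binom_def facts A_def[symmetric] B_def[symmetric]
    by (simp add: AB)
qed

end
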